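(* Let $\Gamma$ be a (finitely generated) hyperbolic group and $\mathbb{K}=\mathbb{R}$ or $\mathbb{C}$. Then there exists $2\le p(\Gamma)<\infty$ such that for any N-functions $\Phi$ and $\Psi$ with $\Phi\in\Delta_2^{\mathbb{N}}$ and such that there are constants $D>0$, $t_0>0$ with $\Psi(t)\le Dt^{p(\Gamma)}$ for all $0<t\le t_0$, the group $\Gamma$ admits a proper affine isometric action on the space $\ell^\Psi(\Gamma,\ell^\Phi(\Gamma,\mathbb{K}))$ equipped with the gauge norm $\|\cdot\|_{(\Psi\Phi)}$.
   Context: An N-function is a convex $\Phi:[0,\infty)\to[0,\infty)$ with $\Phi(0)=0$, $0<\Phi(t)<\infty$ for $t>0$, $\lim_{t\to0}\Phi(t)/t=0$, $\lim_{t\to\infty}\Phi(t)/t=\infty$. $\Phi\in\Delta_2^{\mathbb{N}}$ means there are $K,t_0>0$ with $\Phi(2t)\le K\Phi(t)$ for all $0<t\le t_0$. $\ell^\Phi(\Gamma,\mathbb{K})$ is the space of $c:\Gamma\to\mathbb{K}$ with $\sum_\gamma\Phi(a|c_\gamma|)<\infty$ for some $a>0$, with gauge norm $\|c\|_{(\Phi)}=\inf\{b>0:\sum_{\gamma\in\Gamma}\Phi(|c_\gamma|/b)\le1\}$. $\ell^\Psi(\Gamma,\ell^\Phi(\Gamma,\mathbb{K}))$ is the space of maps $\xi:\Gamma\to\ell^\Phi(\Gamma,\mathbb{K})$ with $\sum_{\gamma\in\Gamma}\Psi(a\|\xi(\gamma)\|_{(\Phi)})<\infty$ for some $a>0$,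 with gauge norm $\|\xi\|_{(\Psi\Phi)}=\inf\{b>0:\sum_{\gamma\in\Gamma}\Psi(\|\xi(\gamma)\|_{(\Phi)}/b)\le1\}$. An affine isometric action $\beta$ of $\Gamma$ on a Banach space $X$ is proper if $\|\beta(g)\xi\|\to\infty$ as $g\to\infty$ in $\Gamma$ (i.e. leaves every finite set), for every $\xi\in X$. *)

theory Defs
  imports "HOL-Analysis.Analysis"
begin

definition gens :: "'g::group_add set \<Rightarrow> 'g set" where
  "gens S = S \<union> uminus ` S"

definition generates :: "'g::group_add set \<Rightarrow> bool" where
  "generates S \<longleftrightarrow> (\<forall>g. \<exists>xs. set xs \<subseteq> gens S \<and> sum_list xs = g)"

definition word_length :: "'g::group_add set \<Rightarrow> 'g \<Rightarrow> nat" where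
  "word_length S g = (LEAST n. \<exists>xs. length xs = n \<and> set xs \<subseteq> gens S \<and> sum_list xs = g)"

definition word_dist :: "'g::group_add set \<Rightarrow> 'g \<Rightarrow> 'g \<Rightarrow> real" where
  "word_dist S g h = real (word_length S (- g + h))"

definition gromov_product :: "'g::group_add set \<Rightarrow> 'g \<Rightarrow> 'g \<Rightarrow> 'g \<Rightarrow> real" where
  "gromov_product S x y w = (word_dist S x w + word_dist S y w - word_dist S x y) / 2"

definition hyperbolic_group :: "'g::group_add itself \<Rightarrow> bool" where
  "hyperbolic_group _ \<longleftrightarrow> (\<exists>(S::'g set) \<delta>. finite S \<and> generates S \<and> \<delta> \<ge> 0 \<and>
     (\<forall>x y z w. gromov_product S x y w \<ge> min (gromov_product S x z w) (gromov_product S y z w) - \<delta>))"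

definition N_function :: "(real \<Rightarrow> real) \<Rightarrow> bool" where
  "N_function \<Phi> \<longleftrightarrow> convex_on {0..} \<Phi> \<and> \<Phi> 0 = 0 \<and> (\<forall>t>0. \<Phi> t > 0) \<and>
     ((\<lambda>t. \<Phi> t / t) \<longlongrightarrow> 0) (at_right 0) \<and> filterlim (\<lambda>t. \<Phi> t / t) at_top at_top"

definition Delta2_zero :: "(real \<Rightarrow> real) \<Rightarrow> bool" where
  "Delta2_zero \<Phi> \<longleftrightarrow> (\<exists>K t0. K > 0 \<and> t0 > 0 \<and> (\<forall>t. 0 < t \<and> t \<le> t0 \<longrightarrow> \<Phi> (2 * t) \<le> K * \<Phi> t))"

definition modular_finite :: "(real \<Rightarrow> real) \<Rightarrow> ('g \<Rightarrow> real) \<Rightarrow> bool" where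
  "modular_finite \<Phi> f \<longleftrightarrow> (\<exists>a>0. (\<lambda>\<gamma>. \<Phi> (a * f \<gamma>)) summable_on UNIV)"

definition gauge :: "(real \<Rightarrow> real) \<Rightarrow> ('g \<Rightarrow> real) \<Rightarrow> real" where
  "gauge \<Phi> f = Inf {b. b > 0 \<and> (\<lambda>\<gamma>. \<Phi> (f \<gamma> / b)) summable_on UNIV \<and>
                        (\<Sum>\<^sub>\<infinity>\<gamma>. \<Phi> (f \<gamma> / b)) \<le> 1}"

definition ell_Phi :: "(real \<Rightarrow> real) \<Rightarrow> ('g \<Rightarrow> 'k::real_normed_field) set" where
  "ell_Phi \<Phi> = {c. modular_finite \<Phi> (\<lambda>\<gamma>. norm (c \<gamma>))}"

definition norm_Phi :: "(real \<Rightarrow> real) \<Rightarrow> ('g \<Rightarrow> 'k::real_normed_field) \<Rightarrow> real" where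
  "norm_Phi \<Phi> c = gauge \<Phi> (\<lambda>\<gamma>. norm (c \<gamma>))"

definition ell_PsiPhi :: "(real \<Rightarrow> real) \<Rightarrow> (real \<Rightarrow> real) \<Rightarrow> ('g \<Rightarrow> 'g \<Rightarrow> 'k::real_normed_field) set" where
  "ell_PsiPhi \<Psi> \<Phi> = {\<xi>. (\<forall>\<gamma>. \<xi> \<gamma> \<in> ell_Phi \<Phi>) \<and> modular_finite \<Psi> (\<lambda>\<gamma>. norm_Phi \<Phi> (\<xi> \<gamma>))}"

definition norm_PsiPhi :: "(real \<Rightarrow> real) \<Rightarrow> (real \<Rightarrow> real) \<Rightarrow> ('g \<Rightarrow> 'g \<Rightarrow> 'k::real_normed_field) \<Rightarrow> real" where
  "norm_PsiPhi \<Psi> \<Phi> \<xi> = gauge \<Psi> (\<lambda>\<gamma>. norm_Phi \<Phi> (\<xi> \<gamma>))"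

definition proper_affine_isometric_action ::
  "(real \<Rightarrow> real) \<Rightarrow> (real \<Rightarrow> real) \<Rightarrow>
   ('g::group_add \<Rightarrow> ('g \<Rightarrow> 'g \<Rightarrow> 'k::real_normed_field) \<Rightarrow> ('g \<Rightarrow> 'g \<Rightarrow> 'k)) \<Rightarrow> bool" where
  "proper_affine_isometric_action \<Psi> \<Phi> \<beta> \<longleftrightarrow>
     (let X = ell_PsiPhi \<Psi> \<Phi>; N = norm_PsiPhi \<Psi> \<Phi> in
       (\<forall>g. \<forall>\<xi>\<in>X. \<beta> g \<xi> \<in> X)
     \<and> (\<forall>\<xi>\<in>X. \<beta> 0 \<xi> = \<xi>)
     \<and> (\<forall>g h. \<forall>\<xi>\<in>X. \<beta> (g + h) \<xi> = \<beta> g (\<beta> h \<xi>))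
     \<and> (\<forall>g. \<forall>\<xi>\<in>X. \<forall>\<eta>\<in>X. \<forall>a::'k.
          \<beta> g (\<lambda>\<gamma> \<delta>. a * \<xi> \<gamma> \<delta> + (1 - a) * \<eta> \<gamma> \<delta>)
          = (\<lambda>\<gamma> \<delta>. a * \<beta> g \<xi> \<gamma> \<delta> + (1 - a) * \<beta> g \<eta> \<gamma> \<delta>))
     \<and> (\<forall>g. \<forall>\<xi>\<in>X. \<forall>\<eta>\<in>X. N (\<beta> g \<xi> - \<beta> g \<eta>) = N (\<xi> - \<eta>))
     \<and> (\<forall>\<xi>\<in>X. \<forall>M. finite {g. N (\<beta> g \<xi>) \<le> M}))"

end

theory Submission
  imports Defs
begin

text \<open>
  For a small \<open>\<epsilon>\<close> the quasi-metric \<open>exp (- \<epsilon> (x|y))\<close>, with the Gromov product based at the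
  identity, is comparable to a chain pseudo-metric \<open>d\<close> (Frink). The finitely many functions \<open>d(\<cdot>, z)\<close>,
  with \<open>z\<close> on a sphere of fixed large radius, are Lipschitz and separate any two points \<open>x\<close>, \<open>y\<close> such that the
  identity lies on a geodesic from \<open>x\<close> to \<open>y\<close>, far from \<open>x\<close>. Since \<open>\<Gamma>\<close> acts freely on
  itself, moving these functions to every base point \<open>\<gamma>\<close> gives an equivariant family
  \<open>\<xi>\<^sub>x(\<gamma>)\<close>, and \<open>g \<mapsto> \<xi>\<^sub>g - \<xi>\<^sub>1\<close> is a cocycle for the translation action. Its size at \<open>\<gamma>\<close> is
  \<open>O(exp (- \<epsilon> |\<gamma>|))\<close>, which \<open>\<Psi>\<close> makes summable as soon as \<open>exp (p \<epsilon>)\<close> exceeds the growth rate of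
  \<open>\<Gamma>\<close>. It is bounded below along a geodesic from \<open>1\<close> to \<open>g\<close>, which gives properness.
\<close>

section \<open>Gauge norms\<close>

lemma N_function_nonneg:
  assumes "N_function \<Phi>" "0 \<le> t"
  shows "0 \<le> \<Phi> t"
  using assms unfolding N_function_def by (cases "t = 0") (auto simp: less_imp_le)

lemma N_function_scale:
  assumes "N_function \<Phi>" "0 \<le> a" "a \<le> 1" "0 \<le> t"
  shows "\<Phi> (a * t) \<le> a * \<Phi> t"
proof -
  have "convex_on {0..} \<Phi>" "\<Phi> 0 = 0"
    using assms by (auto simp: N_function_def)
  from convex_onD[OF this(1) assms(2,3), of 0 t] this(2) assms(4) show ?thesis
    by simp
qed

lemma N_function_mono:
  assumes "N_function \<Phi>" "0 \<le> s" "s \<le> t"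
  shows "\<Phi> s \<le> \<Phi> t"
proof (cases "t = 0")
  case False
  hence "t > 0" using assms by simp
  have "\<Phi> (s / t * t) \<le> s / t * \<Phi> t"
    by (rule N_function_scale) (use assms \<open>t > 0\<close> in auto)
  also have "\<dots> \<le> 1 * \<Phi> t"
    by (rule mult_right_mono) (use assms \<open>t > 0\<close> in \<open>auto intro: N_function_nonneg[OF assms(1)]\<close>)
  finally show ?thesis using \<open>t > 0\<close> by simp
qed (use assms in auto)

lemma N_function_exceeds_one:
  assumes "N_function \<Phi>"
  obtains T where "T > 0" "\<Phi> T > 1"
proof -
  have "filterlim (\<lambda>t. \<Phi> t / t) at_top at_top"
    using assms by (auto simp: N_function_def)
  hence "eventually (\<lambda>t. \<Phi> t / t > 1) at_top"
    by (simp add: filterlim_at_top_dense)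
  moreover have "eventually (\<lambda>t::real. t \<ge> 1) at_top"
    by (rule eventually_ge_at_top)
  ultimately have "eventually (\<lambda>t. \<Phi> t / t > 1 \<and> t \<ge> 1) at_top"
    by (rule eventually_conj)
  then obtain t where "\<Phi> t / t > 1" "t \<ge> 1"
    by (metis (mono_tags, lifting) eventually_at_top_linorder order_refl)
  hence "\<Phi> t > 1"
    by (simp add: less_divide_eq)
  with \<open>t \<ge> 1\<close> show ?thesis by (intro that[of t]) auto
qed

text \<open>Convexity gives \<open>\<Phi> (1 / q) \<le> \<Phi> 1 / q\<close>, and \<open>q\<close>
  is large enough to absorb \<open>m * \<Phi> 1\<close>. A function on \<open>m\<close> points with
  values at most \<open>\<tau>\<close> then has modular at most 1.\<close>

lemma N_function_small:
  assumes "N_function \<Phi>"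
  obtains \<tau> where "\<tau> > 0" "real m * \<Phi> \<tau> \<le> 1"
proof
  define q where "q = 1 + real m * \<Phi> 1"
  have q: "q \<ge> 1" using N_function_nonneg[OF assms, of 1] by (simp add: q_def)
  show "1 / q > 0" using q by simp
  have "\<Phi> (1 / q * 1) \<le> 1 / q * \<Phi> 1"
    by (rule N_function_scale) (use assms q in auto)
  hence "real m * \<Phi> (1 / q) \<le> real m * (1 / q * \<Phi> 1)"
    by (intro mult_left_mono) auto
  also have "\<dots> \<le> 1" using q by (simp add: field_simps q_def)
  finally show "real m * \<Phi> (1 / q) \<le> 1" .
qed

section \<open>Admissible scales and the gauge\<close>

text \<open>For nonnegative \<open>f\<close> and an N-function these are the scales in the
  definition of \<open>gauge\<close>, with the infinite sum replaced by a uniform bound on finite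
  partial sums. Nonemptiness, which amounts to finite modular, has to be tracked because
  \<open>Inf {}\<close> carries no information.\<close>

definition gauge_set :: "(real \<Rightarrow> real) \<Rightarrow> ('g \<Rightarrow> real) \<Rightarrow> real set" where
  "gauge_set \<Phi> f = {b. b > 0 \<and> (\<forall>F. finite F \<longrightarrow> (\<Sum>\<gamma>\<in>F. \<Phi> (f \<gamma> / b)) \<le> 1)}"

lemma summable_infsum_le_iff_finite_sums:
  fixes f :: "'g \<Rightarrow> real"
  assumes "\<And>x. 0 \<le> f x"
  shows "f summable_on UNIV \<and> infsum f UNIV \<le> c \<longleftrightarrow> (\<forall>F. finite F \<longrightarrow> sum f F \<le> c)"
proof safe
  fix F :: "'g set"
  assume "f summable_on UNIV" "infsum f UNIV \<le> c" "finite F"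
  thus "sum f F \<le> c"
    using finite_sum_le_infsum[of f UNIV F] assms by fastforce
next
  assume *: "\<forall>F. finite F \<longrightarrow> sum f F \<le> c"
  show "f summable_on UNIV"
    by (rule nonneg_bdd_above_summable_on) (use * assms in \<open>auto intro!: bdd_aboveI2\<close>)
  thus "infsum f UNIV \<le> c"
    by (rule infsum_le_finite_sums) (use * in auto)
qed

lemma gauge_eq_Inf_gauge_set:
  assumes "N_function \<Phi>" "\<And>x. 0 \<le> f x"
  shows "gauge \<Phi> f = Inf (gauge_set \<Phi> f)"
proof -
  have "{b. b > 0 \<and> (\<lambda>\<gamma>. \<Phi> (f \<gamma> / b)) summable_on UNIV \<and> (\<Sum>\<^sub>\<infinity>\<gamma>. \<Phi> (f \<gamma> / b)) \<le> 1}
      = gauge_set \<Phi> f"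
    unfolding gauge_set_def
    by (intro Collect_cong conj_cong refl summable_infsum_le_iff_finite_sums
          N_function_nonneg[OF assms(1)]) (use assms(2) in auto)
  thus ?thesis by (simp add: gauge_def)
qed

lemma modular_finite_iff_gauge_set:
  assumes "N_function \<Phi>" "\<And>x. 0 \<le> f x"
  shows "modular_finite \<Phi> f \<longleftrightarrow> gauge_set \<Phi> f \<noteq> {}"
proof
  assume "modular_finite \<Phi> f"
  then obtain a where a: "a > 0" "(\<lambda>\<gamma>. \<Phi> (a * f \<gamma>)) summable_on UNIV"
    by (auto simp: modular_finite_def)
  define s where "s = infsum (\<lambda>\<gamma>. \<Phi> (a * f \<gamma>)) UNIV"
  have nn: "0 \<le> \<Phi> (a * f \<gamma>)" for \<gamma>
    using a assms(2) by (intro N_function_nonneg[OF assms(1)]) auto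
  have s: "s \<ge> 0" unfolding s_def by (rule infsum_nonneg) (use nn in auto)
  \<comment> \<open>Enlarging the scale \<open>1 / a\<close> by the factor
    \<open>s + 1 \<ge> 1\<close> shrinks the modular \<open>s\<close>, by convexity, to at most
    \<open>s / (s + 1)\<close>.\<close>
  have "(s + 1) / a \<in> gauge_set \<Phi> f"
    unfolding gauge_set_def
  proof (safe)
    show "0 < (s + 1) / a" using a s by simp
    fix F :: "'a set" assume F: "finite F"
    have "(\<Sum>\<gamma>\<in>F. \<Phi> (f \<gamma> / ((s + 1) / a))) \<le> (\<Sum>\<gamma>\<in>F. 1 / (s + 1) * \<Phi> (a * f \<gamma>))"
    proof (rule sum_mono)
      fix \<gamma>
      have "\<Phi> (1 / (s + 1) * (a * f \<gamma>)) \<le> 1 / (s + 1) * \<Phi> (a * f \<gamma>)"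
        by (rule N_function_scale) (use assms a s in auto)
      thus "\<Phi> (f \<gamma> / ((s + 1) / a)) \<le> 1 / (s + 1) * \<Phi> (a * f \<gamma>)"
        by (simp add: mult.commute)
    qed
    also have "\<dots> = 1 / (s + 1) * (\<Sum>\<gamma>\<in>F. \<Phi> (a * f \<gamma>))"
      by (simp add: sum_distrib_left)
    also have "\<dots> \<le> 1 / (s + 1) * s"
      unfolding s_def
      by (intro mult_left_mono finite_sum_le_infsum) (use a F nn s in \<open>auto simp: s_def\<close>)
    also have "\<dots> \<le> 1" using s by simp
    finally show "(\<Sum>\<gamma>\<in>F. \<Phi> (f \<gamma> / ((s + 1) / a))) \<le> 1" .
  qed
  thus "gauge_set \<Phi> f \<noteq> {}" by blast
next
  assume "gauge_set \<Phi> f \<noteq> {}"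
  then obtain b where b: "b > 0" "\<forall>F. finite F \<longrightarrow> (\<Sum>\<gamma>\<in>F. \<Phi> (f \<gamma> / b)) \<le> 1"
    by (auto simp: gauge_set_def)
  have "(\<lambda>\<gamma>. \<Phi> (f \<gamma> / b)) summable_on UNIV"
    using summable_infsum_le_iff_finite_sums[of "\<lambda>\<gamma>. \<Phi> (f \<gamma> / b)" 1] b assms(2)
    by (simp add: N_function_nonneg[OF assms(1)])
  thus "modular_finite \<Phi> f"
    unfolding modular_finite_def using b(1) by (intro exI[of _ "1 / b"]) auto
qed

lemma bdd_below_gauge_set: "bdd_below (gauge_set \<Phi> f)"
  by (intro bdd_belowI[of _ 0]) (auto simp: gauge_set_def)

lemma gauge_le:
  assumes "N_function \<Phi>" "\<And>x. 0 \<le> f x" "b \<in> gauge_set \<Phi> f"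
  shows "gauge \<Phi> f \<le> b"
  using gauge_eq_Inf_gauge_set[of \<Phi> f] cInf_lower[OF assms(3) bdd_below_gauge_set] assms by simp

lemma gauge_nonneg:
  assumes "N_function \<Phi>" "\<And>x. 0 \<le> f x" "gauge_set \<Phi> f \<noteq> {}"
  shows "0 \<le> gauge \<Phi> f"
proof -
  have "Inf (gauge_set \<Phi> f) \<ge> 0"
    by (intro cInf_greatest) (use assms in \<open>auto simp: gauge_set_def\<close>)
  thus ?thesis using gauge_eq_Inf_gauge_set[of \<Phi> f] assms by simp
qed

lemma gauge_lessE:
  assumes "N_function \<Phi>" "\<And>x. 0 \<le> f x" "gauge_set \<Phi> f \<noteq> {}" "gauge \<Phi> f < r"
  obtains b where "b \<in> gauge_set \<Phi> f" "b < r"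
  using gauge_eq_Inf_gauge_set[of \<Phi> f] assms cInf_lessD[of "gauge_set \<Phi> f" r] by auto

text \<open>The quotient \<open>(f + h) / (b + c)\<close> is the convex combination of
  \<open>f / b\<close> and \<open>h / c\<close> with weights \<open>b / (b + c)\<close> and
  \<open>c / (b + c)\<close>. Asking only for domination by \<open>f + h\<close> covers sums and
  differences alike.\<close>

lemma gauge_set_add:
  assumes \<Phi>: "N_function \<Phi>" and nn: "\<And>x. 0 \<le> f x" "\<And>x. 0 \<le> h x" "\<And>x. 0 \<le> u x"
    and le: "\<And>x. u x \<le> f x + h x"
    and b: "b \<in> gauge_set \<Phi> f" and c: "c \<in> gauge_set \<Phi> h"
  shows "b + c \<in> gauge_set \<Phi> u"
  unfolding gauge_set_def
proof safe
  have pos: "b > 0" "c > 0" using b c by (auto simp: gauge_set_def)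
  thus "0 < b + c" by simp
  define t where "t = c / (b + c)"
  have t: "0 \<le> t" "t \<le> 1" "1 - t = b / (b + c)"
    using pos by (auto simp: t_def field_simps)
  fix F :: "'a set" assume F: "finite F"
  have "(\<Sum>\<gamma>\<in>F. \<Phi> (u \<gamma> / (b + c))) \<le> (\<Sum>\<gamma>\<in>F. (1 - t) * \<Phi> (f \<gamma> / b) + t * \<Phi> (h \<gamma> / c))"
  proof (rule sum_mono)
    fix \<gamma>
    have "\<Phi> (u \<gamma> / (b + c)) \<le> \<Phi> ((f \<gamma> + h \<gamma>) / (b + c))"
      by (rule N_function_mono[OF \<Phi>]) (use nn le pos in \<open>auto intro!: divide_right_mono\<close>)
    also have "(f \<gamma> + h \<gamma>) / (b + c) = (1 - t) * (f \<gamma> / b) + t * (h \<gamma> / c)"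
      unfolding t(3) using pos by (simp add: t_def add_divide_distrib)
    also have "\<Phi> \<dots> \<le> (1 - t) * \<Phi> (f \<gamma> / b) + t * \<Phi> (h \<gamma> / c)"
      using convex_onD[of "{0..}" \<Phi> t "f \<gamma> / b" "h \<gamma> / c"] \<Phi> t nn pos
      by (auto simp: N_function_def)
    finally show "\<Phi> (u \<gamma> / (b + c)) \<le> (1 - t) * \<Phi> (f \<gamma> / b) + t * \<Phi> (h \<gamma> / c)" .
  qed
  also have "\<dots> = (1 - t) * (\<Sum>\<gamma>\<in>F. \<Phi> (f \<gamma> / b)) + t * (\<Sum>\<gamma>\<in>F. \<Phi> (h \<gamma> / c))"
    by (simp add: sum.distrib sum_distrib_left)
  also have "\<dots> \<le> (1 - t) * 1 + t * 1"
    by (intro add_mono mult_left_mono) (use b c t F in \<open>auto simp: gauge_set_def\<close>)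
  finally show "(\<Sum>\<gamma>\<in>F. \<Phi> (u \<gamma> / (b + c))) \<le> 1" by simp
qed

lemma gauge_triangle:
  assumes \<Phi>: "N_function \<Phi>" and nn: "\<And>x. 0 \<le> f x" "\<And>x. 0 \<le> h x" "\<And>x. 0 \<le> u x"
    and le: "\<And>x. u x \<le> f x + h x"
    and ne: "gauge_set \<Phi> f \<noteq> {}" "gauge_set \<Phi> h \<noteq> {}"
  shows "gauge \<Phi> u \<le> gauge \<Phi> f + gauge \<Phi> h"
proof (rule field_le_epsilon)
  fix e :: real assume "e > 0"
  obtain b where b: "b \<in> gauge_set \<Phi> f" "b < gauge \<Phi> f + e / 2"
    using gauge_lessE[of \<Phi> f "gauge \<Phi> f + e / 2"] \<Phi> nn(1) ne(1) \<open>e > 0\<close> by auto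
  obtain c where c: "c \<in> gauge_set \<Phi> h" "c < gauge \<Phi> h + e / 2"
    using gauge_lessE[of \<Phi> h "gauge \<Phi> h + e / 2"] \<Phi> nn(2) ne(2) \<open>e > 0\<close> by auto
  have "b + c \<in> gauge_set \<Phi> u"
    by (rule gauge_set_add[OF \<Phi> nn(1,2,3) le b(1) c(1)])
  hence "gauge \<Phi> u \<le> b + c"
    by (rule gauge_le[OF \<Phi> nn(3)])
  thus "gauge \<Phi> u \<le> gauge \<Phi> f + gauge \<Phi> h + e" using b c by simp
qed

text \<open>Counting tool for properness: a bounded gauge leaves room for few points with values at
  least \<open>c\<close>. The infimum need not be attained, so the bound is relaxed to
  \<open>M + 1\<close> to get an admissible scale below it.\<close>

lemma card_times_le_if_gauge_le:
  assumes \<Phi>: "N_function \<Phi>" and nn: "\<And>x. 0 \<le> f x" and ne: "gauge_set \<Phi> f \<noteq> {}"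
    and A: "finite A" "\<And>x. x \<in> A \<Longrightarrow> c \<le> f x" and "0 \<le> c" and M: "gauge \<Phi> f \<le> M"
  shows "real (card A) * \<Phi> (c / (M + 1)) \<le> 1"
proof -
  obtain b where b: "b \<in> gauge_set \<Phi> f" "b < M + 1"
    using gauge_lessE[of \<Phi> f "M + 1"] \<Phi> nn ne M by force
  have "b > 0" using b by (simp add: gauge_set_def)
  have "real (card A) * \<Phi> (c / (M + 1)) = (\<Sum>x\<in>A. \<Phi> (c / (M + 1)))" by simp
  also have "\<dots> \<le> (\<Sum>x\<in>A. \<Phi> (f x / b))"
  proof (intro sum_mono N_function_mono[OF \<Phi>])
    fix x assume "x \<in> A"
    show "0 \<le> c / (M + 1)" using \<open>0 \<le> c\<close> b \<open>b > 0\<close> by simp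
    show "c / (M + 1) \<le> f x / b"
      using A(2)[OF \<open>x \<in> A\<close>] b \<open>b > 0\<close> \<open>0 \<le> c\<close> nn by (intro frac_le) auto
  qed
  also have "\<dots> \<le> 1" using b A(1) by (auto simp: gauge_set_def)
  finally show ?thesis .
qed

text \<open>At a scale \<open>b\<close> with \<open>f x / b \<ge> T\<close>, the single term at
  \<open>x\<close> would already exceed 1.\<close>

lemma gauge_ge_of_point:
  assumes \<Phi>: "N_function \<Phi>" and nn: "\<And>x. 0 \<le> f x" and ne: "gauge_set \<Phi> f \<noteq> {}"
    and "0 < T" "1 < \<Phi> T"
  shows "f x / T \<le> gauge \<Phi> f"
proof -
  have "f x / T \<le> b" if b: "b \<in> gauge_set \<Phi> f" for b
  proof -
    have "b > 0" using b by (simp add: gauge_set_def)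
    have "(\<Sum>y\<in>{x}. \<Phi> (f y / b)) \<le> 1"
      using b unfolding gauge_set_def by blast
    hence "\<not> T \<le> f x / b"
      using N_function_mono[OF \<Phi>, of T "f x / b"] assms(4,5) by auto
    thus ?thesis using \<open>b > 0\<close> \<open>0 < T\<close> by (simp add: field_simps)
  qed
  hence "f x / T \<le> Inf (gauge_set \<Phi> f)" using ne by (intro cInf_greatest) auto
  thus ?thesis using gauge_eq_Inf_gauge_set[of \<Phi> f] \<Phi> nn by simp
qed

lemma gauge_set_finite_support:
  assumes \<Phi>: "N_function \<Phi>" and nn: "\<And>x. 0 \<le> f x" and A: "finite A"
    and supp: "\<And>x. x \<notin> A \<Longrightarrow> f x = 0" and B: "\<And>x. f x \<le> B" "B > 0"
    and \<tau>: "\<tau> > 0" "real (card A) * \<Phi> \<tau> \<le> 1"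
  shows "B / \<tau> \<in> gauge_set \<Phi> f"
  unfolding gauge_set_def
proof safe
  show "0 < B / \<tau>" using B \<tau> by simp
  fix F :: "'a set" assume F: "finite F"
  have \<Phi>0: "\<Phi> 0 = 0" using \<Phi> by (simp add: N_function_def)
  have "(\<Sum>x\<in>F. \<Phi> (f x / (B / \<tau>))) = (\<Sum>x\<in>F \<inter> A. \<Phi> (f x / (B / \<tau>)))"
    by (rule sum.mono_neutral_right) (use F supp \<Phi>0 in auto)
  also have "\<dots> \<le> (\<Sum>x\<in>F \<inter> A. \<Phi> \<tau>)"
  proof (intro sum_mono N_function_mono[OF \<Phi>])
    fix x
    show "0 \<le> f x / (B / \<tau>)" using nn B \<tau> by simp
    show "f x / (B / \<tau>) \<le> \<tau>" using B(1)[of x] B(2) \<tau>(1) by (simp add: field_simps)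
  qed
  also have "\<dots> \<le> (\<Sum>x\<in>A. \<Phi> \<tau>)"
    by (rule sum_mono2) (use A \<tau> N_function_nonneg[OF \<Phi>] in auto)
  also have "\<dots> \<le> 1" using \<tau> by simp
  finally show "(\<Sum>x\<in>F. \<Phi> (f x / (B / \<tau>))) \<le> 1" .
qed

section \<open>Invariance under bijections and the sequence spaces\<close>

lemma gauge_reindex:
  assumes "bij \<sigma>"
  shows "gauge \<Phi> (\<lambda>\<gamma>. f (\<sigma> \<gamma>)) = gauge \<Phi> f"
  unfolding gauge_def
  using summable_on_reindex_bij_betw[OF assms, of "\<lambda>\<gamma>. \<Phi> (f \<gamma> / b)" for b]
    infsum_reindex_bij_betw[OF assms, of "\<lambda>\<gamma>. \<Phi> (f \<gamma> / b)" for b]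
  by simp

lemma modular_finite_reindex:
  assumes "bij \<sigma>"
  shows "modular_finite \<Phi> (\<lambda>\<gamma>. f (\<sigma> \<gamma>)) \<longleftrightarrow> modular_finite \<Phi> f"
  unfolding modular_finite_def
  using summable_on_reindex_bij_betw[OF assms, of "\<lambda>\<gamma>. \<Phi> (a * f \<gamma>)" for a]
  by simp

lemma ell_Phi_iff:
  assumes "N_function \<Phi>"
  shows "c \<in> ell_Phi \<Phi> \<longleftrightarrow> gauge_set \<Phi> (\<lambda>\<gamma>. norm (c \<gamma>)) \<noteq> {}"
  unfolding ell_Phi_def using modular_finite_iff_gauge_set[OF assms, of "\<lambda>\<gamma>. norm (c \<gamma>)"] by simp

lemma norm_Phi_nonneg:
  assumes "N_function \<Phi>" "c \<in> ell_Phi \<Phi>"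
  shows "0 \<le> norm_Phi \<Phi> c"
  using assms ell_Phi_iff[OF assms(1), of c] unfolding norm_Phi_def
  by (intro gauge_nonneg) auto

lemma ell_Phi_dominated:
  fixes c d e :: "'g \<Rightarrow> 'k::real_normed_field"
  assumes "N_function \<Phi>" "c \<in> ell_Phi \<Phi>" "d \<in> ell_Phi \<Phi>"
    and le: "\<And>\<gamma>. norm (e \<gamma>) \<le> norm (c \<gamma>) + norm (d \<gamma>)"
  shows "e \<in> ell_Phi \<Phi>" "norm_Phi \<Phi> e \<le> norm_Phi \<Phi> c + norm_Phi \<Phi> d"
proof -
  from assms(2,3) have ne: "gauge_set \<Phi> (\<lambda>\<gamma>. norm (c \<gamma>)) \<noteq> {}" "gauge_set \<Phi> (\<lambda>\<gamma>. norm (d \<gamma>)) \<noteq> {}"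
    using ell_Phi_iff[OF assms(1)] by auto
  show "norm_Phi \<Phi> e \<le> norm_Phi \<Phi> c + norm_Phi \<Phi> d"
    unfolding norm_Phi_def by (rule gauge_triangle[OF assms(1)]) (use le ne in auto)
  from ne obtain b b' where "b \<in> gauge_set \<Phi> (\<lambda>\<gamma>. norm (c \<gamma>))" "b' \<in> gauge_set \<Phi> (\<lambda>\<gamma>. norm (d \<gamma>))"
    by auto
  from gauge_set_add[OF assms(1) _ _ _ le this] show "e \<in> ell_Phi \<Phi>"
    using ell_Phi_iff[OF assms(1), of e] by auto
qed

lemma ell_PsiPhi_iff:
  assumes "N_function \<Phi>" "N_function \<Psi>"
  shows "\<xi> \<in> ell_PsiPhi \<Psi> \<Phi> \<longleftrightarrow>
    (\<forall>\<gamma>. \<xi> \<gamma> \<in> ell_Phi \<Phi>) \<and> gauge_set \<Psi> (\<lambda>\<gamma>. norm_Phi \<Phi> (\<xi> \<gamma>)) \<noteq> {}"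
  unfolding ell_PsiPhi_def
  using modular_finite_iff_gauge_set[OF assms(2), of "\<lambda>\<gamma>. norm_Phi \<Phi> (\<xi> \<gamma>)"] norm_Phi_nonneg[OF assms(1)]
  by auto

text \<open>Pointwise domination passes through the inner gauge and then the outer one. This gives
  at once the closure of the space under the affine maps and the triangle inequality used for
  properness.\<close>

lemma ell_PsiPhi_dominated:
  fixes \<xi> \<eta> \<zeta> :: "'g \<Rightarrow> 'g \<Rightarrow> 'k::real_normed_field"
  assumes "N_function \<Phi>" "N_function \<Psi>" "\<xi> \<in> ell_PsiPhi \<Psi> \<Phi>" "\<eta> \<in> ell_PsiPhi \<Psi> \<Phi>"
    and le: "\<And>\<gamma> \<delta>. norm (\<zeta> \<gamma> \<delta>) \<le> norm (\<xi> \<gamma> \<delta>) + norm (\<eta> \<gamma> \<delta>)"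
  shows "\<zeta> \<in> ell_PsiPhi \<Psi> \<Phi>" "norm_PsiPhi \<Psi> \<Phi> \<zeta> \<le> norm_PsiPhi \<Psi> \<Phi> \<xi> + norm_PsiPhi \<Psi> \<Phi> \<eta>"
proof -
  note iff = ell_PsiPhi_iff[OF assms(1,2)]
  from assms(3,4) have mem: "\<xi> \<gamma> \<in> ell_Phi \<Phi>" "\<eta> \<gamma> \<in> ell_Phi \<Phi>" for \<gamma>
    by (auto simp: iff)
  from assms(3,4) have ne: "gauge_set \<Psi> (\<lambda>\<gamma>. norm_Phi \<Phi> (\<xi> \<gamma>)) \<noteq> {}"
    "gauge_set \<Psi> (\<lambda>\<gamma>. norm_Phi \<Phi> (\<eta> \<gamma>)) \<noteq> {}" by (auto simp: iff)
  have \<zeta>: "\<zeta> \<gamma> \<in> ell_Phi \<Phi>" for \<gamma>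
    by (rule ell_Phi_dominated(1)[OF assms(1) mem le])
  have le': "norm_Phi \<Phi> (\<zeta> \<gamma>) \<le> norm_Phi \<Phi> (\<xi> \<gamma>) + norm_Phi \<Phi> (\<eta> \<gamma>)" for \<gamma>
    by (rule ell_Phi_dominated(2)[OF assms(1) mem le])
  note nn = norm_Phi_nonneg[OF assms(1) mem(1)] norm_Phi_nonneg[OF assms(1) mem(2)]
    norm_Phi_nonneg[OF assms(1) \<zeta>]
  show "norm_PsiPhi \<Psi> \<Phi> \<zeta> \<le> norm_PsiPhi \<Psi> \<Phi> \<xi> + norm_PsiPhi \<Psi> \<Phi> \<eta>"
    unfolding norm_PsiPhi_def by (rule gauge_triangle[OF assms(2) nn le' ne])
  from ne obtain b b' where "b \<in> gauge_set \<Psi> (\<lambda>\<gamma>. norm_Phi \<Phi> (\<xi> \<gamma>))"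
    "b' \<in> gauge_set \<Psi> (\<lambda>\<gamma>. norm_Phi \<Phi> (\<eta> \<gamma>))" by auto
  from gauge_set_add[OF assms(2) nn le' this] \<zeta> show "\<zeta> \<in> ell_PsiPhi \<Psi> \<Phi>"
    by (auto simp: iff)
qed

section \<open>Affine actions from formal primitives\<close>

text \<open>The diagonal left regular action, moving base point and inner variable together.\<close>

definition translate :: "'g::group_add \<Rightarrow> ('g \<Rightarrow> 'g \<Rightarrow> 'k) \<Rightarrow> 'g \<Rightarrow> 'g \<Rightarrow> 'k" where
  "translate g \<xi> = (\<lambda>\<gamma> \<delta>. \<xi> (- g + \<gamma>) (- g + \<delta>))"

lemma bij_add_left: "bij (\<lambda>x::'g::group_add. g + x)"
  by (rule bij_betwI[of _ _ _ "\<lambda>x. - g + x"]) (auto simp flip: add.assoc)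

lemma norm_Phi_translate:
  "norm_Phi \<Phi> (translate g \<xi> \<gamma>) = norm_Phi \<Phi> (\<xi> (- g + \<gamma>))"
  unfolding norm_Phi_def translate_def
  by (rule gauge_reindex[OF bij_add_left, where f = "\<lambda>\<delta>. norm (\<xi> (- g + \<gamma>) \<delta>)"])

lemma norm_PsiPhi_translate: "norm_PsiPhi \<Psi> \<Phi> (translate g \<xi>) = norm_PsiPhi \<Psi> \<Phi> \<xi>"
  unfolding norm_PsiPhi_def norm_Phi_translate
  by (rule gauge_reindex[OF bij_add_left, where f = "\<lambda>\<gamma>. norm_Phi \<Phi> (\<xi> \<gamma>)"])

lemma translate_ell_PsiPhi:
  assumes "\<xi> \<in> ell_PsiPhi \<Psi> \<Phi>"
  shows "translate g \<xi> \<in> ell_PsiPhi \<Psi> \<Phi>"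
proof -
  have "translate g \<xi> \<gamma> \<in> ell_Phi \<Phi>" for \<gamma>
    using assms
      modular_finite_reindex[OF bij_add_left[of "- g"], of \<Phi> "\<lambda>\<delta>. norm (\<xi> (- g + \<gamma>) \<delta>)"]
    by (auto simp: ell_PsiPhi_def ell_Phi_def translate_def)
  thus ?thesis using assms
      modular_finite_reindex[OF bij_add_left[of "- g"], of \<Psi> "\<lambda>\<gamma>. norm_Phi \<Phi> (\<xi> \<gamma>)"]
    by (auto simp: ell_PsiPhi_def norm_Phi_translate)
qed

text \<open>The family \<open>\<xi>\<close> itself need not lie in the space; only the coboundary
  \<open>\<xi> g - \<xi> 0\<close> of this formal primitive does.\<close>

lemma proper_affine_isometric_action_of_primitive:
  fixes \<xi> :: "'g::group_add \<Rightarrow> 'g \<Rightarrow> 'g \<Rightarrow> 'k::real_normed_field"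
  assumes "N_function \<Phi>" "N_function \<Psi>"
    and equiv: "\<And>g x. translate g (\<xi> x) = \<xi> (g + x)"
    and mem: "\<And>g. \<xi> g - \<xi> 0 \<in> ell_PsiPhi \<Psi> \<Phi>"
    and proper: "\<And>M. finite {g. norm_PsiPhi \<Psi> \<Phi> (\<xi> g - \<xi> 0) \<le> M}"
  defines "\<beta> \<equiv> \<lambda>g \<eta> \<gamma> \<delta>. translate g \<eta> \<gamma> \<delta> + (\<xi> g \<gamma> \<delta> - \<xi> 0 \<gamma> \<delta>)"
  shows "proper_affine_isometric_action \<Psi> \<Phi> \<beta>"
  unfolding proper_affine_isometric_action_def Let_def
proof (intro conjI allI ballI)
  have closed: "\<beta> g \<eta> \<in> ell_PsiPhi \<Psi> \<Phi>" if \<eta>: "\<eta> \<in> ell_PsiPhi \<Psi> \<Phi>" for g \<eta>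
    by (rule ell_PsiPhi_dominated(1)[OF assms(1,2) translate_ell_PsiPhi[OF \<eta>, of g] mem[of g]])
       (simp add: \<beta>_def norm_triangle_ineq)
  {
    fix g and \<eta> :: "'g \<Rightarrow> 'g \<Rightarrow> 'k" assume "\<eta> \<in> ell_PsiPhi \<Psi> \<Phi>"
    thus "\<beta> g \<eta> \<in> ell_PsiPhi \<Psi> \<Phi>" by (rule closed)
  next
    fix \<eta> :: "'g \<Rightarrow> 'g \<Rightarrow> 'k"
    show "\<beta> 0 \<eta> = \<eta>" by (simp add: \<beta>_def translate_def)
  next
    fix g h and \<eta> :: "'g \<Rightarrow> 'g \<Rightarrow> 'k"
    \<comment> \<open>Equivariance makes \<open>\<xi> g - \<xi> 0\<close> a cocycle: translating
      \<open>\<xi> h - \<xi> 0\<close> by \<open>g\<close> gives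
      \<open>\<xi> (g + h) - \<xi> g\<close>, and the sum with \<open>\<xi> g - \<xi> 0\<close>
      telescopes.\<close>
    have "\<xi> x (- g + \<gamma>) (- g + \<delta>) = \<xi> (g + x) \<gamma> \<delta>" for x \<gamma> \<delta>
      using fun_cong[OF fun_cong[OF equiv[of g x]], of \<gamma> \<delta>] by (simp add: translate_def)
    thus "\<beta> (g + h) \<eta> = \<beta> g (\<beta> h \<eta>)"
      by (simp add: \<beta>_def translate_def minus_add flip: add.assoc)
  next
    fix g and \<eta> \<zeta> :: "'g \<Rightarrow> 'g \<Rightarrow> 'k" and a :: 'k
    show "\<beta> g (\<lambda>\<gamma> \<delta>. a * \<eta> \<gamma> \<delta> + (1 - a) * \<zeta> \<gamma> \<delta>)
      = (\<lambda>\<gamma> \<delta>. a * \<beta> g \<eta> \<gamma> \<delta> + (1 - a) * \<beta> g \<zeta> \<gamma> \<delta>)"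
      by (simp add: \<beta>_def translate_def fun_eq_iff algebra_simps)
  next
    fix g and \<eta> \<zeta> :: "'g \<Rightarrow> 'g \<Rightarrow> 'k"
    have "\<beta> g \<eta> - \<beta> g \<zeta> = translate g (\<eta> - \<zeta>)"
      by (simp add: \<beta>_def translate_def fun_eq_iff)
    thus "norm_PsiPhi \<Psi> \<Phi> (\<beta> g \<eta> - \<beta> g \<zeta>) = norm_PsiPhi \<Psi> \<Phi> (\<eta> - \<zeta>)"
      by (simp add: norm_PsiPhi_translate)
  next
    fix \<eta> :: "'g \<Rightarrow> 'g \<Rightarrow> 'k" and M assume \<eta>: "\<eta> \<in> ell_PsiPhi \<Psi> \<Phi>"
    \<comment> \<open>The cocycle is \<open>\<beta> g \<eta>\<close> minus the translate of
      \<open>\<eta>\<close>, whose norm does not depend on \<open>g\<close>. Properness at every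
      \<open>\<eta>\<close> thus reduces to that of the cocycle.\<close>
    have "norm_PsiPhi \<Psi> \<Phi> (\<xi> g - \<xi> 0)
        \<le> norm_PsiPhi \<Psi> \<Phi> (\<beta> g \<eta>) + norm_PsiPhi \<Psi> \<Phi> (translate g \<eta>)" for g
    proof (rule ell_PsiPhi_dominated(2)[OF assms(1,2) closed[OF \<eta>] translate_ell_PsiPhi[OF \<eta>]])
      show "norm ((\<xi> g - \<xi> 0) \<gamma> \<delta>) \<le> norm (\<beta> g \<eta> \<gamma> \<delta>) + norm (translate g \<eta> \<gamma> \<delta>)" for \<gamma> \<delta>
        using norm_triangle_ineq4[of "\<beta> g \<eta> \<gamma> \<delta>" "translate g \<eta> \<gamma> \<delta>"] by (simp add: \<beta>_def)
    qed
    hence bound: "norm_PsiPhi \<Psi> \<Phi> (\<xi> g - \<xi> 0) \<le> norm_PsiPhi \<Psi> \<Phi> (\<beta> g \<eta>) + norm_PsiPhi \<Psi> \<Phi> \<eta>" for g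
      by (simp only: norm_PsiPhi_translate)
    have "{g. norm_PsiPhi \<Psi> \<Phi> (\<beta> g \<eta>) \<le> M}
        \<subseteq> {g. norm_PsiPhi \<Psi> \<Phi> (\<xi> g - \<xi> 0) \<le> M + norm_PsiPhi \<Psi> \<Phi> \<eta>}"
      using order_trans[OF bound add_right_mono] by blast
    thus "finite {g. norm_PsiPhi \<Psi> \<Phi> (\<beta> g \<eta>) \<le> M}"
      using proper finite_subset by blast
  }
qed

section \<open>Chain pseudo-metrics\<close>

fun chain_weight :: "('a \<Rightarrow> 'a \<Rightarrow> real) \<Rightarrow> 'a \<Rightarrow> 'a list \<Rightarrow> real" where
  "chain_weight \<rho> x [] = 0"
| "chain_weight \<rho> x (y # ys) = \<rho> x y + chain_weight \<rho> y ys"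

text \<open>For nonnegative \<open>\<rho>\<close> this is the largest function below
  \<open>\<rho>\<close> that satisfies the triangle inequality. The list holds the points after
  \<open>x\<close>; since it is nonempty, the value on the diagonal is not forced to be 0.\<close>

definition chain_dist :: "('a \<Rightarrow> 'a \<Rightarrow> real) \<Rightarrow> 'a \<Rightarrow> 'a \<Rightarrow> real" where
  "chain_dist \<rho> x z = Inf {chain_weight \<rho> x ys | ys. ys \<noteq> [] \<and> last ys = z}"

lemma chain_weight_append:
  "chain_weight \<rho> x (us @ vs) = chain_weight \<rho> x us + chain_weight \<rho> (last (x # us)) vs"
  by (induction us arbitrary: x) auto

lemma chain_weight_nonneg:
  assumes "\<And>x y. 0 \<le> \<rho> x y"
  shows "0 \<le> chain_weight \<rho> x ys"
  by (induction ys arbitrary: x) (auto simp: assms)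

lemma chain_weight_split:
  assumes "0 \<le> c" "c < chain_weight \<rho> x ys"
  shows "\<exists>us v vs. ys = us @ v # vs \<and> chain_weight \<rho> x us \<le> c \<and> c < chain_weight \<rho> x (us @ [v])"
  using assms(2)
proof (induction ys rule: rev_induct)
  case (snoc y ys)
  show ?case
  proof (cases "c < chain_weight \<rho> x ys")
    case True
    then obtain us v vs where "ys = us @ v # vs" "chain_weight \<rho> x us \<le> c"
      "c < chain_weight \<rho> x (us @ [v])" using snoc.IH by blast
    thus ?thesis by (intro exI[of _ us] exI[of _ v] exI[of _ "vs @ [y]"]) auto
  next
    case False
    thus ?thesis using snoc.prems by (intro exI[of _ ys] exI[of _ y] exI[of _ "[]"]) auto
  qed
qed (use assms(1) in auto)

text \<open>Frink's argument: cut the chain at the link which crosses half of its total weight.\<close>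

lemma quasi_ultrametric_le_chain_weight:
  fixes \<rho> :: "'a \<Rightarrow> 'a \<Rightarrow> real"
  assumes pos: "\<And>x y. 0 < \<rho> x y" and K: "1 \<le> K" "K * K \<le> 2"
    and quasi: "\<And>x y z. \<rho> x z \<le> K * max (\<rho> x y) (\<rho> y z)"
    and "ys \<noteq> []"
  shows "\<rho> x (last ys) \<le> 2 * chain_weight \<rho> x ys"
  using \<open>ys \<noteq> []\<close>
proof (induction ys arbitrary: x rule: length_induct)
  case (1 ys)
  have nn: "0 \<le> \<rho> x y" for x y using pos[of x y] by simp
  note wnn = chain_weight_nonneg[of \<rho>, OF nn]
  define a where "a = chain_weight \<rho> x ys"
  have "a > 0" using "1.prems" pos wnn unfolding a_def
    by (cases ys) (auto intro: add_pos_nonneg)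
  have step: "\<rho> u w \<le> K * b" if "\<rho> u v \<le> b" "\<rho> v w \<le> b" for u v w b
  proof -
    have "K * max (\<rho> u v) (\<rho> v w) \<le> K * b" using that K by (intro mult_left_mono) auto
    thus ?thesis using quasi[of u w v] by linarith
  qed
  have aK: "a \<le> K * a" "K * a \<le> 2 * a" 
  proof -
    show "a \<le> K * a" using K \<open>a > 0\<close> by simp
    have "K * 1 \<le> K * K" using K by (intro mult_left_mono) auto
    hence "K \<le> 2" using K by linarith
    thus "K * a \<le> 2 * a" using \<open>a > 0\<close> by simp
  qed
  have KKa: "K * (K * a) \<le> 2 * a" using K \<open>a > 0\<close> by (metis less_imp_le mult.assoc mult_right_mono)
  obtain us v vs where ys: "ys = us @ v # vs" and us: "chain_weight \<rho> x us \<le> a / 2"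
    and usv: "a / 2 < chain_weight \<rho> x (us @ [v])"
    using chain_weight_split[of "a / 2" \<rho> x ys] \<open>a > 0\<close> by (auto simp: a_def)
  have a_eq: "a = chain_weight \<rho> x us + \<rho> (last (x # us)) v + chain_weight \<rho> v vs"
    unfolding a_def ys by (simp add: chain_weight_append)
  have vs: "chain_weight \<rho> v vs \<le> a / 2"
    using usv a_eq by (simp add: chain_weight_append)
  have mid: "\<rho> (last (x # us)) v \<le> a" using a_eq wnn[of x us] wnn[of v vs] by linarith
  \<comment> \<open>Each part beside the middle link weighs at most \<open>a / 2\<close>, so by
    induction its ends are within \<open>a\<close>, as are those of the middle link. Joining the
    three pieces costs a factor \<open>K\<close> twice, and \<open>K * K \<le> 2\<close>. Empty
    parts are treated apart because the induction hypothesis needs a nonempty chain.\<close>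
  have xv: "\<rho> x v \<le> K * a"
  proof (cases "us = []")
    case True thus ?thesis using mid aK by simp
  next
    case False
    hence "\<rho> x (last us) \<le> 2 * chain_weight \<rho> x us" using "1.IH" ys by auto
    thus ?thesis using step[of x "last us" a v] mid False us by simp
  qed
  show ?case
  proof (cases "vs = []")
    case True thus ?thesis using xv aK ys by (simp add: a_def)
  next
    case False
    hence "\<rho> v (last vs) \<le> 2 * chain_weight \<rho> v vs" using "1.IH" ys by auto
    hence "\<rho> v (last vs) \<le> K * a" using vs aK by linarith
    from step[OF xv this] KKa show ?thesis using False ys by (simp add: a_def)
  qed
qed

lemma chain_dist_le:
  assumes "\<And>x y. 0 \<le> \<rho> x y" "ys \<noteq> []" "last ys = z"
  shows "chain_dist \<rho> x z \<le> chain_weight \<rho> x ys"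
  unfolding chain_dist_def
  by (rule cInf_lower) (use assms chain_weight_nonneg[of \<rho>, OF assms(1)] in \<open>auto intro!: bdd_belowI[of _ 0]\<close>)

lemma chain_dist_greatest:
  assumes "\<And>ys. ys \<noteq> [] \<Longrightarrow> last ys = z \<Longrightarrow> c \<le> chain_weight \<rho> x ys"
  shows "c \<le> chain_dist \<rho> x z"
proof -
  have "chain_weight \<rho> x [z] \<in> {chain_weight \<rho> x ys | ys. ys \<noteq> [] \<and> last ys = z}"
    by (intro CollectI exI[of _ "[z]"]) auto
  thus ?thesis unfolding chain_dist_def by (intro cInf_greatest) (use assms in auto)
qed

text \<open>Any chain from \<open>y\<close> to \<open>z\<close> becomes one from \<open>x\<close> to
  \<open>z\<close> by prepending the link to \<open>y\<close>.\<close>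

lemma chain_dist_step:
  assumes "\<And>x y. 0 \<le> \<rho> x y"
  shows "chain_dist \<rho> x z \<le> \<rho> x y + chain_dist \<rho> y z"
proof -
  have "chain_dist \<rho> x z - \<rho> x y \<le> chain_dist \<rho> y z"
  proof (rule chain_dist_greatest)
    fix ys assume "ys \<noteq> []" "last ys = z"
    thus "chain_dist \<rho> x z - \<rho> x y \<le> chain_weight \<rho> y ys"
      using chain_dist_le[of \<rho> "y # ys" z x, OF assms] by simp
  qed
  thus ?thesis by simp
qed

section \<open>The cocycle of a hyperbolic group\<close>

locale hyperbolic_generators =
  fixes S :: "'g::group_add set" and \<delta> :: real
  assumes finite_S: "finite S" and generates_S: "generates S" and \<delta>_nonneg: "0 \<le> \<delta>"
    and hyperbolic:
      "gromov_product S x y w \<ge> min (gromov_product S x z w) (gromov_product S y z w) - \<delta>"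
begin

section \<open>Word length, geodesics and growth\<close>

abbreviation len :: "'g \<Rightarrow> nat" where "len \<equiv> word_length S"

lemma word_length_witness:
  obtains xs where "length xs = len g" "set xs \<subseteq> gens S" "sum_list xs = g"
proof -
  have "\<exists>n xs. length xs = n \<and> set xs \<subseteq> gens S \<and> sum_list xs = g"
    using generates_S by (auto simp: generates_def)
  from LeastI_ex[OF this] that show ?thesis unfolding word_length_def by blast
qed

lemma word_length_le:
  assumes "set xs \<subseteq> gens S"
  shows "len (sum_list xs) \<le> length xs"
  unfolding word_length_def by (rule Least_le) (use assms in auto)

lemma word_length_zero [simp]: "len 0 = 0"
  using word_length_le[of "[]"] by simp

lemma word_length_add: "len (g + h) \<le> len g + len h"
proof -
  obtain xs where xs: "length xs = len g" "set xs \<subseteq> gens S" "sum_list xs = g"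
    by (rule word_length_witness)
  obtain ys where ys: "length ys = len h" "set ys \<subseteq> gens S" "sum_list ys = h"
    by (rule word_length_witness)
  show ?thesis using word_length_le[of "xs @ ys"] xs ys by simp
qed

lemma word_length_uminus_le: "len (- g) \<le> len g"
proof -
  obtain xs where xs: "length xs = len g" "set xs \<subseteq> gens S" "sum_list xs = g"
    by (rule word_length_witness)
  have "sum_list (rev (map uminus xs)) = - sum_list xs"
    by (induction xs) (auto simp: minus_add)
  moreover have "set (rev (map uminus xs)) \<subseteq> gens S"
    using xs(2) by (force simp: gens_def)
  ultimately show ?thesis using word_length_le[of "rev (map uminus xs)"] xs by simp
qed

lemma word_length_uminus [simp]: "len (- g) = len g"
  using word_length_uminus_le[of g] word_length_uminus_le[of "- g"] by simp

lemma word_length_diff_commute: "len (- x + y) = len (- y + x)"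
  using word_length_uminus[of "- x + y"] by (simp add: minus_add)

text \<open>Cut a shortest word for \<open>g\<close> after \<open>k\<close> letters; subadditivity
  forces both pieces to be shortest words too.\<close>

lemma geodesic_point:
  assumes "k \<le> len g"
  obtains \<gamma> where "len \<gamma> = k" "len (- \<gamma> + g) = len g - k"
proof -
  obtain xs where xs: "length xs = len g" "set xs \<subseteq> gens S" "sum_list xs = g"
    by (rule word_length_witness)
  define \<gamma> where "\<gamma> = sum_list (take k xs)"
  have g: "g = \<gamma> + sum_list (drop k xs)"
    unfolding \<gamma>_def using xs(3) by (metis append_take_drop_id sum_list_append)
  have 1: "len \<gamma> \<le> k"
    using word_length_le[of "take k xs"] xs assms set_take_subset[of k xs] by (auto simp: \<gamma>_def)
  have "len (- \<gamma> + g) = len (sum_list (drop k xs))"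
    by (subst g) (simp flip: add.assoc)
  hence 2: "len (- \<gamma> + g) \<le> len g - k"
    using word_length_le[of "drop k xs"] xs set_drop_subset[of k xs] by auto
  have "len g \<le> len \<gamma> + len (- \<gamma> + g)"
    using word_length_add[of \<gamma> "- \<gamma> + g"] by (simp flip: add.assoc)
  with 1 2 assms that[of \<gamma>] show ?thesis by linarith
qed

lemma sphere_finite_card: "finite {g. len g = k}" "card {g. len g = k} \<le> card (gens S) ^ k"
proof -
  have fin: "finite (gens S)" using finite_S by (simp add: gens_def)
  let ?L = "{xs. set xs \<subseteq> gens S \<and> length xs = k}"
  have sub: "{g. len g = k} \<subseteq> sum_list ` ?L"
  proof
    fix g assume "g \<in> {g. len g = k}"
    moreover obtain xs where "length xs = len g" "set xs \<subseteq> gens S" "sum_list xs = g"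
      by (rule word_length_witness)
    ultimately show "g \<in> sum_list ` ?L" by auto
  qed
  have finL: "finite ?L" using fin by (rule finite_lists_length_eq)
  show "finite {g. len g = k}" using sub finL finite_surj by blast
  have "card {g. len g = k} \<le> card ?L" using surj_card_le[OF finL sub] .
  also have "\<dots> = card (gens S) ^ k" using fin by (rule card_lists_length_eq)
  finally show "card {g. len g = k} \<le> card (gens S) ^ k" .
qed

lemma finite_word_ball: "finite {g. len g \<le> n}"
proof -
  have "{g. len g \<le> n} = (\<Union>k\<le>n. {g. len g = k})" by auto
  thus ?thesis using sphere_finite_card(1) by simp
qed

text \<open>Summing over spheres, the one of radius \<open>k\<close> contributes at most
  \<open>(q * card (gens S)) ^ k\<close>, which a geometric series dominates.\<close>

lemma summable_word_length:
  assumes q: "0 \<le> q" "q * real (card (gens S)) \<le> 1 / 2"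
  shows "(\<lambda>\<gamma>. q ^ len \<gamma>) summable_on UNIV"
proof (rule nonneg_bdd_above_summable_on)
  show "0 \<le> q ^ len \<gamma>" for \<gamma> using q by simp
  have "(\<Sum>\<gamma>\<in>F. q ^ len \<gamma>) \<le> 2" if F: "finite F" for F
  proof -
    have "(\<Sum>\<gamma>\<in>F. q ^ len \<gamma>) = (\<Sum>k\<in>len ` F. \<Sum>\<gamma>\<in>{\<gamma> \<in> F. len \<gamma> = k}. q ^ len \<gamma>)"
      by (rule sum.image_gen[OF F])
    also have "\<dots> \<le> (\<Sum>k\<in>len ` F. (1 / 2) ^ k)"
    proof (rule sum_mono)
      fix k
      have "(\<Sum>\<gamma>\<in>{\<gamma> \<in> F. len \<gamma> = k}. q ^ len \<gamma>) = real (card {\<gamma> \<in> F. len \<gamma> = k}) * q ^ k"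
        by simp
      also have "card {\<gamma> \<in> F. len \<gamma> = k} \<le> card (gens S) ^ k"
        by (rule order_trans[OF card_mono[OF sphere_finite_card(1)] sphere_finite_card(2)]) auto
      hence "real (card {\<gamma> \<in> F. len \<gamma> = k}) * q ^ k \<le> real (card (gens S)) ^ k * q ^ k"
        using q by (intro mult_right_mono) (auto simp flip: of_nat_power)
      also have "\<dots> = (q * real (card (gens S))) ^ k" by (simp add: power_mult_distrib)
      also have "\<dots> \<le> (1 / 2) ^ k" using q by (intro power_mono) auto
      finally show "(\<Sum>\<gamma>\<in>{\<gamma> \<in> F. len \<gamma> = k}. q ^ len \<gamma>) \<le> (1 / 2) ^ k" .
    qed
    also have "\<dots> \<le> (\<Sum>k. (1 / 2) ^ k)"
      by (rule sum_le_suminf) (use F in auto)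
    also have "\<dots> = (2::real)" by (simp add: suminf_geometric)
    finally show ?thesis .
  qed
  thus "bdd_above (sum (\<lambda>\<gamma>. q ^ len \<gamma>) ` {F. F \<subseteq> UNIV \<and> finite F})"
    by (intro bdd_aboveI2[of _ _ 2]) auto
qed

section \<open>The Gromov product and the visual pseudo-metric\<close>

definition gp :: "'g \<Rightarrow> 'g \<Rightarrow> real" where
  "gp x y = (real (len x) + real (len y) - real (len (- x + y))) / 2"

lemma gp_eq: "gp x y = gromov_product S x y 0"
  by (simp add: gp_def gromov_product_def word_dist_def)

lemma gp_commute: "gp x y = gp y x"
  by (simp add: gp_def word_length_diff_commute[of x y])

lemma gp_hyperbolic: "min (gp x y) (gp y z) - \<delta> \<le> gp x z"
  using hyperbolic[where x = x and y = z and z = y and w = 0] gp_commute[of y z] by (simp add: gp_eq)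

text \<open>The rate is chosen so that \<open>exp (2 * \<delta> * rate) \<le> 2\<close>, as needed for Frink's argument.\<close>

definition rate :: real where "rate = ln 2 / (2 * \<delta> + 1)"

definition visual :: "'g \<Rightarrow> 'g \<Rightarrow> real" where "visual x y = exp (- rate * gp x y)"

lemma rate_pos: "rate > 0"
  using \<delta>_nonneg by (simp add: rate_def)

lemma visual_pos: "0 < visual x y"
  by (simp add: visual_def)

text \<open>Exponentiating turns the additive defect \<open>\<delta>\<close> of hyperbolicity into
  the factor \<open>exp (rate * \<delta>)\<close>.\<close>

lemma visual_quasi: "visual x z \<le> exp (rate * \<delta>) * max (visual x y) (visual y z)"
proof -
  have "min (gp x y) (gp y z) - \<delta> \<le> gp x z" by (rule gp_hyperbolic)
  hence "rate * (min (gp x y) (gp y z) - \<delta>) \<le> rate * gp x z"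
    using rate_pos by (intro mult_left_mono) auto
  hence "visual x z \<le> exp (rate * \<delta> + - rate * min (gp x y) (gp y z))"
    by (simp add: visual_def algebra_simps)
  also have "\<dots> = exp (rate * \<delta>) * exp (- rate * min (gp x y) (gp y z))"
    by (rule exp_add)
  also have "exp (- rate * min (gp x y) (gp y z)) \<le> max (visual x y) (visual y z)"
    by (auto simp: visual_def min_def)
  finally show ?thesis by simp
qed

definition vdist :: "'g \<Rightarrow> 'g \<Rightarrow> real" where "vdist = chain_dist visual"

lemma vdist_le: "vdist x z \<le> visual x z"
  using chain_dist_le[of visual "[z]" z x] visual_pos by (simp add: vdist_def less_imp_le)

lemma vdist_ge: "visual x z / 2 \<le> vdist x z"
  unfolding vdist_def
proof (rule chain_dist_greatest)
  fix ys assume ys: "ys \<noteq> []" "last ys = z"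
  have "2 * rate * \<delta> \<le> ln 2"
    using \<delta>_nonneg by (simp add: rate_def field_simps)
  hence "exp (2 * rate * \<delta>) \<le> 2"
    by (metis exp_le_cancel_iff exp_ln zero_less_numeral)
  hence "exp (rate * \<delta>) * exp (rate * \<delta>) \<le> 2"
    by (simp add: mult_ac flip: exp_add)
  moreover have "1 \<le> exp (rate * \<delta>)" using rate_pos \<delta>_nonneg by simp
  ultimately have "visual x (last ys) \<le> 2 * chain_weight visual x ys"
    using quasi_ultrametric_le_chain_weight[where \<rho> = visual, OF visual_pos _ _ visual_quasi ys(1)] by blast
  thus "visual x z / 2 \<le> chain_weight visual x ys" using ys(2) by simp
qed

lemma vdist_Lipschitz: "\<bar>vdist x z - vdist y z\<bar> \<le> visual x y"
  using chain_dist_step[of visual x z y] chain_dist_step[of visual y z x] visual_pos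
  by (force simp: vdist_def visual_def gp_commute[of y x] less_imp_le)

text \<open>Large enough that \<open>exp (- rate * radius)\<close> is at most a quarter of
  \<open>exp (- rate * \<delta>)\<close>, and larger than \<open>\<delta>\<close>.\<close>

definition radius :: nat where "radius = nat \<lceil>\<delta> + ln 4 / rate\<rceil>"

lemma radius_ge: "\<delta> + ln 4 / rate \<le> real radius"
  unfolding radius_def by linarith

lemma radius_gt: "\<delta> < real radius"
proof -
  have "ln 4 / rate > 0" using rate_pos by simp
  thus ?thesis using radius_ge by linarith
qed

lemma exp_radius: "exp (- rate * real radius) \<le> exp (- rate * \<delta>) / 4"
proof -
  have "rate * (\<delta> + ln 4 / rate) \<le> rate * real radius"
    using radius_ge rate_pos by (intro mult_left_mono) auto
  hence "exp (- rate * real radius) \<le> exp (- rate * \<delta> - ln 4)"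
    using rate_pos by (simp add: algebra_simps)
  also have "\<dots> = exp (- rate * \<delta>) / 4" by (simp add: exp_diff)
  finally show ?thesis .
qed

text \<open>Take \<open>z\<close> at distance \<open>radius\<close> from the identity on a geodesic
  to \<open>x\<close>, so that \<open>gp x z = radius\<close> and \<open>vdist x z\<close> is small.
  As \<open>gp x y \<le> 0\<close> and \<open>radius > \<delta>\<close>, hyperbolicity forces
  \<open>gp y z \<le> \<delta>\<close>, so \<open>vdist y z\<close> is at least twice the bound on
  \<open>vdist x z\<close>.\<close>

lemma vdist_separates:
  assumes x: "radius \<le> len x" and gp0: "gp x y \<le> 0"
  obtains z where "len z = radius" "exp (- rate * \<delta>) / 4 \<le> vdist y z - vdist x z"
proof -
  obtain z where z: "len z = radius" "len (- z + x) = len x - radius"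
    using geodesic_point[OF x] by blast
  have gxz: "gp x z = real radius"
    using z x by (simp add: gp_def word_length_diff_commute[of x z] of_nat_diff)
  have "gp y z \<le> \<delta>"
    using gp_hyperbolic[of x z y] gxz gp0 radius_gt gp_commute[of y z] by (auto simp: min_def split: if_splits)
  hence "exp (- rate * \<delta>) \<le> visual y z"
    using rate_pos by (simp add: visual_def)
  hence "exp (- rate * \<delta>) / 2 \<le> vdist y z" using vdist_ge[of y z] by linarith
  moreover have "vdist x z \<le> exp (- rate * \<delta>) / 4"
    using vdist_le[of x z] exp_radius by (simp add: visual_def gxz)
  ultimately show ?thesis using z(1) that[of z] by linarith
qed

text \<open>No equivariance is required of the functions \<open>vdist\<close> themselves: \<open>primitive x \<gamma>\<close> is
  \<open>z \<mapsto> vdist x z\<close> on the sphere about the origin, carried to the base point \<open>\<gamma>\<close>.\<close>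

definition primitive :: "'g \<Rightarrow> 'g \<Rightarrow> 'g \<Rightarrow> 'k::real_normed_field" where
  "primitive x \<gamma> \<zeta> = (if len (- \<gamma> + \<zeta>) = radius then of_real (vdist (- \<gamma> + x) (- \<gamma> + \<zeta>)) else 0)"

section \<open>Equivariance and decay of the coboundary\<close>

lemma translate_primitive: "translate g (primitive x) = primitive (g + x)"
  by (auto simp: translate_def primitive_def fun_eq_iff minus_add add.assoc)

text \<open>The Lipschitz bound for \<open>vdist\<close> reduces this to
  \<open>visual (- \<gamma> + g) (- \<gamma>)\<close>, which is small because the triangle
  inequality bounds that Gromov product below by \<open>len \<gamma> - len g\<close>.\<close>

lemma norm_primitive_diff_le:
  "norm ((primitive g \<gamma> - primitive 0 \<gamma>) \<zeta> :: 'k::real_normed_field)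
    \<le> exp (rate * len g) * exp (- rate * len \<gamma>)"
proof (cases "len (- \<gamma> + \<zeta>) = radius")
  case True
  have "real (len \<gamma>) - real (len g) \<le> gp (- \<gamma> + g) (- \<gamma>)"
  proof -
    have "len (- (- \<gamma> + g) + - \<gamma>) = len g" by (simp add: minus_add add.assoc)
    moreover have "len \<gamma> \<le> len g + len (- \<gamma> + g)"
      using word_length_add[of g "- g + \<gamma>"] word_length_diff_commute[of \<gamma> g]
      by (simp flip: add.assoc)
    ultimately show ?thesis by (simp add: gp_def)
  qed
  hence "rate * (real (len \<gamma>) - real (len g)) \<le> rate * gp (- \<gamma> + g) (- \<gamma>)"
    using rate_pos by (intro mult_left_mono) auto
  hence "visual (- \<gamma> + g) (- \<gamma>) \<le> exp (rate * len g + - rate * len \<gamma>)"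
    by (simp add: visual_def algebra_simps)
  hence "visual (- \<gamma> + g) (- \<gamma>) \<le> exp (rate * len g) * exp (- rate * len \<gamma>)"
    by (simp only: exp_add)
  moreover have "norm ((primitive g \<gamma> - primitive 0 \<gamma>) \<zeta> :: 'k)
      = \<bar>vdist (- \<gamma> + g) (- \<gamma> + \<zeta>) - vdist (- \<gamma>) (- \<gamma> + \<zeta>)\<bar>"
    using True by (simp add: primitive_def flip: of_real_diff)
  ultimately show ?thesis
    using vdist_Lipschitz[of "- \<gamma> + g" "- \<gamma> + \<zeta>" "- \<gamma>"] by linarith
qed (simp add: primitive_def)

text \<open>At \<open>\<gamma>\<close> the coboundary lives on the sphere translated by
  \<open>\<gamma>\<close>. Its cardinality is the same for all \<open>\<gamma>\<close>, so one
  \<open>\<tau>\<close> serves everywhere.\<close>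

lemma primitive_diff_gauge_set:
  assumes "N_function \<Phi>" "\<tau> > 0" "real (card {z. len z = radius}) * \<Phi> \<tau> \<le> 1"
  shows "exp (rate * len g) * exp (- rate * len \<gamma>) / \<tau>
    \<in> gauge_set \<Phi> (\<lambda>\<zeta>. norm ((primitive g \<gamma> - primitive 0 \<gamma>) \<zeta> :: 'k::real_normed_field))"
proof (rule gauge_set_finite_support[OF assms(1), where A = "(\<lambda>z. \<gamma> + z) ` {z. len z = radius}"])
  show "finite ((\<lambda>z. \<gamma> + z) ` {z. len z = radius})" using sphere_finite_card(1) by simp
  show "real (card ((\<lambda>z. \<gamma> + z) ` {z. len z = radius})) * \<Phi> \<tau> \<le> 1"
    using assms(3) by (subst card_image) (auto simp: inj_on_def)
  show "norm ((primitive g \<gamma> - primitive 0 \<gamma>) \<zeta> :: 'k) = 0"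
    if "\<zeta> \<notin> (\<lambda>z. \<gamma> + z) ` {z. len z = radius}" for \<zeta>
  proof -
    have "\<zeta> = \<gamma> + (- \<gamma> + \<zeta>)" by (simp flip: add.assoc)
    hence "len (- \<gamma> + \<zeta>) \<noteq> radius" using that by blast
    thus ?thesis by (simp add: primitive_def)
  qed
qed (use norm_primitive_diff_le assms in auto)

section \<open>The exponent and summability\<close>

text \<open>The second entry makes \<open>exp (rate * exponent)\<close> beat twice the number of
  letters, hence the growth of spheres; the \<open>+ 1\<close> keeps the logarithm meaningful when
  there are no letters. Only \<open>S\<close> and \<open>\<delta>\<close> enter, so the value
  precedes the choice of \<open>\<Phi>\<close> and \<open>\<Psi>\<close>.\<close>

definition exponent :: real where
  "exponent = max 2 (ln (2 * real (card (gens S)) + 1) / rate)"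

lemma exp_exponent: "exp (- rate * exponent) * real (card (gens S)) \<le> 1 / 2"
proof -
  let ?m = "real (card (gens S))"
  have "ln (2 * ?m + 1) / rate \<le> exponent" by (simp add: exponent_def)
  hence "ln (2 * ?m + 1) \<le> rate * exponent" using rate_pos by (simp add: field_simps)
  hence "exp (- rate * exponent) \<le> exp (- ln (2 * ?m + 1))" by simp
  also have "\<dots> = 1 / (2 * ?m + 1)" by (simp add: exp_minus inverse_eq_divide)
  finally have "exp (- rate * exponent) * ?m \<le> 1 / (2 * ?m + 1) * ?m"
    by (intro mult_right_mono) auto
  also have "\<dots> \<le> 1 / 2" by (simp add: field_simps)
  finally show ?thesis .
qed

lemma primitive_diff_mem:
  assumes \<Phi>: "N_function \<Phi>" and \<Psi>: "N_function \<Psi>"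
    and "D > 0" "t0 > 0" and bound: "\<And>t. 0 < t \<Longrightarrow> t \<le> t0 \<Longrightarrow> \<Psi> t \<le> D * t powr exponent"
  shows "(primitive g - primitive 0 :: 'g \<Rightarrow> 'g \<Rightarrow> 'k::real_normed_field) \<in> ell_PsiPhi \<Psi> \<Phi>"
proof -
  obtain \<tau> where \<tau>: "\<tau> > 0" "real (card {z. len z = radius}) * \<Phi> \<tau> \<le> 1"
    by (rule N_function_small[OF \<Phi>])
  let ?b = "primitive g - primitive 0 :: 'g \<Rightarrow> 'g \<Rightarrow> 'k"
  define C where "C = exp (rate * len g) / \<tau>"
  have "C > 0" using \<tau> by (simp add: C_def)
  have gs: "C * exp (- rate * len \<gamma>) \<in> gauge_set \<Phi> (\<lambda>\<zeta>. norm (?b \<gamma> \<zeta>))" for \<gamma>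
    using primitive_diff_gauge_set[OF \<Phi> \<tau>, of g \<gamma>] by (simp add: C_def)
  hence mem: "?b \<gamma> \<in> ell_Phi \<Phi>" for \<gamma>
    using ell_Phi_iff[OF \<Phi>, of "?b \<gamma>"] by blast
  have le: "norm_Phi \<Phi> (?b \<gamma>) \<le> C * exp (- rate * len \<gamma>)" for \<gamma>
    unfolding norm_Phi_def by (rule gauge_le[OF \<Phi> _ gs]) simp
  \<comment> \<open>Rescales the bound \<open>C * exp (- rate * len \<gamma>)\<close> to at most
    \<open>t0\<close>, where the power bound on \<open>\<Psi>\<close> applies.\<close>
  define a where "a = t0 / C"
  have "a > 0" using \<open>C > 0\<close> \<open>t0 > 0\<close> by (simp add: a_def)
  define q where "q = exp (- rate * exponent)"
  have est: "\<Psi> (a * norm_Phi \<Phi> (?b \<gamma>)) \<le> D * t0 powr exponent * q ^ len \<gamma>" for \<gamma>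
  proof -
    have "a * norm_Phi \<Phi> (?b \<gamma>) \<le> a * (C * exp (- rate * len \<gamma>))"
      using le \<open>a > 0\<close> by (intro mult_left_mono) auto
    also have "\<dots> = t0 * exp (- rate * len \<gamma>)" using \<open>C > 0\<close> by (simp add: a_def)
    finally have "\<Psi> (a * norm_Phi \<Phi> (?b \<gamma>)) \<le> \<Psi> (t0 * exp (- rate * len \<gamma>))"
      using norm_Phi_nonneg[OF \<Phi> mem] \<open>a > 0\<close> by (intro N_function_mono[OF \<Psi>]) auto
    also have "\<dots> \<le> D * (t0 * exp (- rate * len \<gamma>)) powr exponent"
      using \<open>t0 > 0\<close> rate_pos by (intro bound) (auto intro: mult_left_le)
    also have "(t0 * exp (- rate * len \<gamma>)) powr exponent = t0 powr exponent * q ^ len \<gamma>"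
      using \<open>t0 > 0\<close> by (simp add: powr_mult q_def exp_powr_real mult_ac flip: exp_of_nat_mult)
    finally show ?thesis by (simp only: mult.assoc)
  qed
  have "(\<lambda>\<gamma>. q ^ len \<gamma>) summable_on UNIV"
    using summable_word_length[of q] exp_exponent by (simp add: q_def)
  hence "(\<lambda>\<gamma>. D * t0 powr exponent * q ^ len \<gamma>) summable_on UNIV"
    by (rule summable_on_cmult_right)
  hence "(\<lambda>\<gamma>. \<Psi> (a * norm_Phi \<Phi> (?b \<gamma>))) summable_on UNIV"
    by (rule summable_on_comparison_test)
       (use est norm_Phi_nonneg[OF \<Phi> mem] N_function_nonneg[OF \<Psi>] \<open>a > 0\<close> in auto)
  hence "modular_finite \<Psi> (\<lambda>\<gamma>. norm_Phi \<Phi> (?b \<gamma>))"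
    using \<open>a > 0\<close> by (auto simp: modular_finite_def)
  thus ?thesis using mem by (auto simp: ell_PsiPhi_def)
qed

section \<open>Lower bounds along geodesics and properness\<close>

text \<open>The length condition puts \<open>\<gamma>\<close> on a geodesic from the identity to
  \<open>g\<close>. Moving \<open>\<gamma>\<close> to the identity makes
  \<open>gp (- \<gamma>) (- \<gamma> + g)\<close> nonpositive, so some \<open>z\<close> on the
  sphere separates the two points, and the coordinate \<open>\<gamma> + z\<close> alone bounds the
  gauge below.\<close>

lemma norm_Phi_primitive_diff_ge:
  fixes g \<gamma> :: 'g
  defines "b \<equiv> primitive g - primitive 0 :: 'g \<Rightarrow> 'g \<Rightarrow> 'k::real_normed_field"
  assumes \<Phi>: "N_function \<Phi>" and T: "0 < T" "1 < \<Phi> T" and mem: "b \<gamma> \<in> ell_Phi \<Phi>"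
    and \<gamma>: "radius \<le> len \<gamma>" "len g \<ge> len \<gamma> + len (- \<gamma> + g)"
  shows "exp (- rate * \<delta>) / 4 / T \<le> norm_Phi \<Phi> (b \<gamma>)"
proof -
  have "gp (- \<gamma>) (- \<gamma> + g) \<le> 0"
    using \<gamma>(2) by (simp add: gp_def flip: add.assoc)
  moreover have "radius \<le> len (- \<gamma>)" using \<gamma>(1) by simp
  ultimately obtain z where z: "len z = radius"
    "exp (- rate * \<delta>) / 4 \<le> vdist (- \<gamma> + g) z - vdist (- \<gamma>) z"
    using vdist_separates by blast
  have "norm (b \<gamma> (\<gamma> + z)) = \<bar>vdist (- \<gamma> + g) z - vdist (- \<gamma>) z\<bar>"
    using z(1) by (simp add: b_def primitive_def flip: of_real_diff add.assoc)
  hence "exp (- rate * \<delta>) / 4 \<le> norm (b \<gamma> (\<gamma> + z))" using z(2) by linarith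
  hence "exp (- rate * \<delta>) / 4 / T \<le> norm (b \<gamma> (\<gamma> + z)) / T"
    using T by (intro divide_right_mono) auto
  also have "\<dots> \<le> norm_Phi \<Phi> (b \<gamma>)"
    unfolding norm_Phi_def
    by (rule gauge_ge_of_point[OF \<Phi> _ _ T, where f = "\<lambda>\<zeta>. norm (b \<gamma> \<zeta>)"])
       (use mem ell_Phi_iff[OF \<Phi>, of "b \<gamma>"] in auto)
  finally show ?thesis .
qed

text \<open>A geodesic from the identity to \<open>g\<close> offers \<open>len g - radius\<close>
  base points where the inner norm is at least a fixed \<open>c\<close>. Bounded outer norm
  therefore bounds \<open>len g\<close>, and word balls are finite.\<close>

lemma primitive_diff_proper:
  assumes \<Phi>: "N_function \<Phi>" and \<Psi>: "N_function \<Psi>"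
    and mem: "\<And>g. (primitive g - primitive 0 :: 'g \<Rightarrow> 'g \<Rightarrow> 'k::real_normed_field) \<in> ell_PsiPhi \<Psi> \<Phi>"
  shows "finite {g. norm_PsiPhi \<Psi> \<Phi> (primitive g - primitive 0 :: 'g \<Rightarrow> 'g \<Rightarrow> 'k) \<le> M}"
proof -
  let ?b = "\<lambda>g. primitive g - primitive 0 :: 'g \<Rightarrow> 'g \<Rightarrow> 'k"
  obtain T where T: "T > 0" "\<Phi> T > 1" by (rule N_function_exceeds_one[OF \<Phi>])
  define c where "c = exp (- rate * \<delta>) / 4 / T"
  have "c > 0" using T by (simp add: c_def)
  \<comment> \<open>Using \<open>max M 0\<close> keeps the argument of \<open>\<Psi>\<close>
    positive when \<open>M\<close> is negative.\<close>
  define \<kappa> where "\<kappa> = \<Psi> (c / (max M 0 + 1))"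
  have "\<kappa> > 0" using \<Psi> \<open>c > 0\<close> by (simp add: \<kappa>_def N_function_def)
  have "real (len g) \<le> 1 / \<kappa> + real radius" if g: "norm_PsiPhi \<Psi> \<Phi> (?b g) \<le> M" for g
  proof -
    have "\<forall>k\<in>{radius..<len g}. \<exists>\<gamma>. len \<gamma> = k \<and> len (- \<gamma> + g) = len g - k"
      using geodesic_point[of _ g] by (metis atLeastLessThan_iff less_imp_le)
    then obtain \<gamma> where \<gamma>: "\<And>k. k \<in> {radius..<len g} \<Longrightarrow> len (\<gamma> k) = k \<and> len (- \<gamma> k + g) = len g - k"
      by metis
    have inj: "inj_on \<gamma> {radius..<len g}" by (rule inj_on_inverseI[of _ len]) (use \<gamma> in blast)
    have mem': "?b g x \<in> ell_Phi \<Phi>" for x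
      using mem[of g] ell_PsiPhi_iff[OF \<Phi> \<Psi>, of "?b g"] by blast
    have lower: "c \<le> norm_Phi \<Phi> (?b g x)" if x: "x \<in> \<gamma> ` {radius..<len g}" for x
      unfolding c_def
      by (rule norm_Phi_primitive_diff_ge[OF \<Phi> T mem']) (use x \<gamma> in auto)
    have "real (card (\<gamma> ` {radius..<len g})) * \<Psi> (c / (max M 0 + 1)) \<le> 1"
    proof (rule card_times_le_if_gauge_le[OF \<Psi> norm_Phi_nonneg[OF \<Phi> mem'] _ _ lower])
      show "gauge_set \<Psi> (\<lambda>x. norm_Phi \<Phi> (?b g x)) \<noteq> {}"
        using mem[of g] ell_PsiPhi_iff[OF \<Phi> \<Psi>, of "?b g"] by blast
      show "gauge \<Psi> (\<lambda>x. norm_Phi \<Phi> (?b g x)) \<le> max M 0"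
        using g by (simp add: norm_PsiPhi_def)
    qed (use \<open>c > 0\<close> in auto)
    \<comment> \<open>Distinct lengths make the chosen points distinct. If
      \<open>len g < radius\<close>, there are none, and truncated subtraction gives 0
      accordingly.\<close>
    hence "real (len g - radius) * \<kappa> \<le> 1" using inj by (simp add: card_image \<kappa>_def)
    hence "real (len g - radius) \<le> 1 / \<kappa>" using \<open>\<kappa> > 0\<close> by (simp add: field_simps)
    thus ?thesis by linarith
  qed
  moreover have "n \<le> nat \<lceil>r\<rceil>" if "real n \<le> r" for n and r :: real
    using that by linarith
  ultimately have
    "{g. norm_PsiPhi \<Psi> \<Phi> (?b g) \<le> M} \<subseteq> {g. len g \<le> nat \<lceil>1 / \<kappa> + real radius\<rceil>}"
    by blast
  thus ?thesis using finite_word_ball finite_subset by blast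
qed

lemma exists_proper_affine_isometric_action:
  assumes \<Phi>: "N_function \<Phi>" and \<Psi>: "N_function \<Psi>"
    and "D > 0" "t0 > 0" and bound: "\<And>t. 0 < t \<Longrightarrow> t \<le> t0 \<Longrightarrow> \<Psi> t \<le> D * t powr exponent"
  shows "\<exists>\<beta> :: 'g \<Rightarrow> ('g \<Rightarrow> 'g \<Rightarrow> 'k::real_normed_field) \<Rightarrow> ('g \<Rightarrow> 'g \<Rightarrow> 'k).
    proper_affine_isometric_action \<Psi> \<Phi> \<beta>"
proof -
  note mem = primitive_diff_mem[OF assms]
  show ?thesis
    using proper_affine_isometric_action_of_primitive[OF \<Phi> \<Psi> translate_primitive mem
      primitive_diff_proper[OF \<Phi> \<Psi> mem]] by blast
qed

end

theorem mainTheorem6: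
  assumes "hyperbolic_group TYPE('g::group_add)"
  shows "\<exists>p::real. 2 \<le> p \<and>
    (\<forall>\<Phi> \<Psi>. N_function \<Phi> \<and> N_function \<Psi> \<and> Delta2_zero \<Phi> \<and>
        (\<exists>D t0. D > 0 \<and> t0 > 0 \<and> (\<forall>t. 0 < t \<and> t \<le> t0 \<longrightarrow> \<Psi> t \<le> D * t powr p))
      \<longrightarrow> (\<exists>\<beta> :: 'g \<Rightarrow> ('g \<Rightarrow> 'g \<Rightarrow> real) \<Rightarrow> ('g \<Rightarrow> 'g \<Rightarrow> real).
              proper_affine_isometric_action \<Psi> \<Phi> \<beta>)
        \<and> (\<exists>\<beta> :: 'g \<Rightarrow> ('g \<Rightarrow> 'g \<Rightarrow> complex) \<Rightarrow> ('g \<Rightarrow> 'g \<Rightarrow> complex).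
              proper_affine_isometric_action \<Psi> \<Phi> \<beta>))"
proof -
  from assms obtain S :: "'g set" and \<delta> where "hyperbolic_generators S \<delta>"
    unfolding hyperbolic_group_def hyperbolic_generators_def by blast
  then interpret hyperbolic_generators S \<delta> .
  show ?thesis
  proof (intro exI[of _ exponent] conjI allI impI; (elim conjE exE)?)
    show "2 \<le> exponent" by (simp add: exponent_def)
  \<comment> \<open>The construction works over any real normed field, so it is used once for
    \<open>real\<close> and once for \<open>complex\<close>.\<close>
  qed (rule exists_proper_affine_isometric_action; blast)+
qed

end
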